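(* Let $\mathbb{F}$ be an arbitrary field, let $V$ be an infinite-dimensional vector space over $\mathbb{F}$, and let $u$ be a finite-rank endomorphism of $V$ with trace zero. Then $u$ is the sum of three square-zero endomorphisms of $V$.
   Context: An endomorphism $a$ of $V$ is square-zero if $a \circ a=0$. The trace of a finite-rank endomorphism $u$ of $V$ is the trace of the endomorphism of $W$ induced by $u$, where $W$ is any finite-dimensional linear subspace of $V$ containing the image of $u$ (this does not depend on the choice of $W$). *)

theory Defs
  imports Main "HOL.Vector_Spaces"
begin

context vector_space
begin

definition finite_dim_subspace :: "'b set \<Rightarrow> bool" where
  "finite_dim_subspace W \<longleftrightarrow> (\<exists>B. finite B \<and> span B = W)"

definition endomorphism :: "('b \<Rightarrow> 'b) \<Rightarrow> bool" where
  "endomorphism u \<longleftrightarrow> Vector_Spaces.linear scale scale u"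

definition finite_rank :: "('b \<Rightarrow> 'b) \<Rightarrow> bool" where
  "finite_rank u \<longleftrightarrow> finite_dim_subspace (range u)"

definition square_zero :: "('b \<Rightarrow> 'b) \<Rightarrow> bool" where
  "square_zero a \<longleftrightarrow> endomorphism a \<and> a \<circ> a = (\<lambda>x. 0)"

(* The trace of the endomorphism of W induced by u: the sum of the diagonal entries of its matrix
   in a basis of W.  Meaningful when W is finite-dimensional and u maps W into W; the choice of
   the basis does not matter, see trace_on_eq. *)
definition trace_on :: "'b set \<Rightarrow> ('b \<Rightarrow> 'b) \<Rightarrow> 'a" where
  "trace_on W u =
    (let B = (SOME B. independent B \<and> span B = W) in \<Sum>b\<in>B. representation B (u b) b)"

(* Meaningful when u is an endomorphism of finite rank; the choice of W does not matter, see
   finite_rank_trace_eq. *)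
definition finite_rank_trace :: "('b \<Rightarrow> 'b) \<Rightarrow> 'a" where
  "finite_rank_trace u =
    trace_on (SOME W. finite_dim_subspace W \<and> range u \<subseteq> W) u"

lemma finite_dim_subspace_basis:
  assumes "finite_dim_subspace W" "independent A" "A \<subseteq> W"
  obtains B where "A \<subseteq> B" "finite B" "independent B" "span B = W"
proof -
  obtain S where S: "finite S" "span S = W"
    using assms(1) unfolding finite_dim_subspace_def by blast
  obtain B where B: "A \<subseteq> B" "B \<subseteq> W" "independent B" "W \<subseteq> span B"
    using maximal_independent_subset_extend[OF assms(3,2)] by blast
  have "finite B"
    using independent_span_bound[OF S(1) B(3)] B(2) S(2) by simp
  moreover have "span B = W"
    using B(2,4) S(2) span_minimal[OF _ subspace_span, of B S] by blast
  ultimately show thesis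
    using that B by blast
qed

lemma trace_basis_change:
  assumes u: "Vector_Spaces.linear scale scale u"
    and B: "finite B" "independent B" and C: "finite C" "independent C"
    and eq: "span B = span C" and inv: "u ` span B \<subseteq> span B"
  shows "(\<Sum>b\<in>B. representation B (u b) b) = (\<Sum>c\<in>C. representation C (u c) c)"
proof -
  interpret u: Vector_Spaces.linear scale scale u by (fact u)
  have uB: "u c \<in> span B" if "c \<in> C" for c
    using inv that eq span_base by blast
  have bC: "b \<in> span C" if "b \<in> B" for b
    using that eq span_base by blast
  have "representation B (u b) b = (\<Sum>c\<in>C. representation C b c * representation B (u c) b)"
    if b: "b \<in> B" for b
  proof -
    have "u b = u (\<Sum>c\<in>C. scale (representation C b c) c)"
      using sum_representation_eq[OF C(2) bC[OF b] C(1) order_refl] by simp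
    also have "\<dots> = (\<Sum>c\<in>C. scale (representation C b c) (u c))"
      by (simp add: u.sum u.scale)
    finally have "representation B (u b) b
        = (\<Sum>c\<in>C. representation B (scale (representation C b c) (u c)) b)"
      using representation_sum[OF B(2), of C "\<lambda>c. scale (representation C b c) (u c)"] uB
      by (simp add: span_scale)
    then show ?thesis
      using representation_scale[OF B(2) uB] by simp
  qed
  then have "(\<Sum>b\<in>B. representation B (u b) b)
      = (\<Sum>b\<in>B. \<Sum>c\<in>C. representation C b c * representation B (u c) b)"
    by simp
  also have "\<dots> = (\<Sum>c\<in>C. \<Sum>b\<in>B. representation B (u c) b * representation C b c)"
    by (subst sum.swap) (simp add: mult.commute)
  also have "\<dots> = (\<Sum>c\<in>C. representation C (u c) c)"
  proof (rule sum.cong[OF refl])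
    fix c assume c: "c \<in> C"
    have "representation C (u c) c
        = representation C (\<Sum>b\<in>B. scale (representation B (u c) b) b) c"
      using sum_representation_eq[OF B(2) uB[OF c] B(1) order_refl] by simp
    also have "\<dots> = (\<Sum>b\<in>B. representation C (scale (representation B (u c) b) b) c)"
      using representation_sum[OF C(2), of B "\<lambda>b. scale (representation B (u c) b) b"] bC
      by (simp add: span_scale)
    also have "\<dots> = (\<Sum>b\<in>B. representation B (u c) b * representation C b c)"
      using representation_scale[OF C(2) bC] by simp
    finally show "(\<Sum>b\<in>B. representation B (u c) b * representation C b c)
        = representation C (u c) c" by simp
  qed
  finally show ?thesis .
qed

lemma trace_on_eq:
  assumes u: "endomorphism u"
    and B: "finite B" "independent B" "span B = W" and inv: "u ` W \<subseteq> W"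
  shows "trace_on W u = (\<Sum>b\<in>B. representation B (u b) b)"
proof -
  define C where "C = (SOME C. independent C \<and> span C = W)"
  have C: "independent C" "span C = W"
    using someI[of "\<lambda>C. independent C \<and> span C = W" B] B unfolding C_def by blast+
  have "finite C"
    using independent_span_bound[OF B(1) C(1)] B(3) C(2) span_superset by blast
  then have "(\<Sum>c\<in>C. representation C (u c) c) = (\<Sum>b\<in>B. representation B (u b) b)"
    using trace_basis_change[of u C B] u B C inv unfolding endomorphism_def by simp
  then show ?thesis
    by (simp add: trace_on_def C_def Let_def)
qed

lemma trace_on_range:
  assumes u: "endomorphism u" and W: "finite_dim_subspace W" "range u \<subseteq> W"
  shows "trace_on W u = trace_on (range u) u"
proof -
  interpret u: Vector_Spaces.linear scale scale u
    using u by (simp add: endomorphism_def)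
  obtain A where A: "A \<subseteq> range u" "independent A" "range u \<subseteq> span A"
    using maximal_independent_subset by blast
  have sA: "span A = range u"
    using A u.subspace_image[OF subspace_UNIV] span_minimal[of A "range u"] by blast
  obtain B where B: "A \<subseteq> B" "finite B" "independent B" "span B = W"
    using finite_dim_subspace_basis[OF W(1) A(2)] A(1) W(2) by blast
  have "finite A"
    using B finite_subset by blast
  have rep: "representation B (u x) = representation A (u x)" for x
    using representation_extend[OF B(3) _ B(1)] sA by blast
  have "trace_on W u = (\<Sum>b\<in>B. representation A (u b) b)"
    using trace_on_eq[OF u B(2-4)] W(2) rep by (simp add: image_subset_iff)
  also have "\<dots> = (\<Sum>b\<in>A. representation A (u b) b)"
    using B(1,2) by (intro sum.mono_neutral_right) (auto dest: representation_ne_zero)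
  also have "\<dots> = trace_on (range u) u"
    using trace_on_eq[OF u \<open>finite A\<close> A(2) sA] by (simp add: image_subset_iff)
  finally show ?thesis .
qed

lemma finite_rank_trace_eq:
  assumes u: "endomorphism u" and W: "finite_dim_subspace W" "range u \<subseteq> W"
  shows "finite_rank_trace u = trace_on W u"
proof -
  define W' where "W' = (SOME W. finite_dim_subspace W \<and> range u \<subseteq> W)"
  have "finite_dim_subspace W' \<and> range u \<subseteq> W'"
    unfolding W'_def by (rule someI[of _ W]) (use W in blast)
  then have "trace_on W' u = trace_on W u"
    using trace_on_range[OF u] W by simp
  then show ?thesis
    by (simp add: finite_rank_trace_def W'_def)
qed

end

end

theory Submission
  imports Defs
begin

text \<open>Let \<open>W\<close> be the range of \<open>u\<close>; it is finite-dimensional, and \<open>u\<close> restricts to an endomorphism \<open>A\<close> of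
  \<open>W\<close> with trace zero. As the kernel of \<open>u\<close> is infinite-dimensional, there is room for a second copy
  of \<open>W\<close> in the space, and \<open>u\<close> may be treated as a \<open>2 \<times> 2\<close> block matrix over \<open>W\<close>
  (\<open>kernel_copy_exists\<close>). One square-zero endomorphism \<open>c\<close> is subtracted so that two square-zero
  endomorphisms suffice for the rest.

  Suppose that \<open>A\<close> is not a nonzero scalar. Then \<open>A = L + U\<close> with \<open>L\<close> and \<open>U\<close> nilpotent, by choosing a basis
  in which the diagonal of \<open>A\<close> is zero (\<open>trace_zero_sum_of_two_nilpotents\<close>). The second copy of
  \<open>W\<close> is placed so that \<open>u\<close> has the block rows \<open>(L + U, U)\<close> and \<open>(0, 0)\<close>. Subtracting the square-zero
  endomorphism with rows \<open>(U, U)\<close> and \<open>(-U, -U)\<close> leaves the rows \<open>(L, 0)\<close> and \<open>(U, U)\<close>, which is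
  nilpotent (\<open>square_zero_plus_nilpotent\<close>). Every nilpotent endomorphism swaps the summands of
  some decomposition of the space into two subspaces, and so is the sum of two square-zero endomorphisms
  (\<open>nilpotent_sum_of_two_square_zero\<close>).

  Suppose that \<open>A\<close> is a scalar \<open>\<mu> \<noteq> 0\<close>. On a nonzero space it is not the sum of two nilpotents,
  but the trace condition says that \<open>dim W\<close> vanishes in the field. Then \<open>1 = N - M\<close> on \<open>W\<close>,
  where \<open>M\<close> is diagonal with entries \<open>0, 1, 2, \<dots>\<close>, and \<open>N = 1 + M\<close> is conjugate to \<open>M\<close> by a
  cyclic shift of the basis. In suitable block coordinates \<open>u\<close> has the diagonal blocks \<open>\<mu> N\<close> and
  \<open>-\<mu> M\<close>, and because \<open>N\<close> and \<open>M\<close> are conjugate, some square-zero endomorphism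
  has the same diagonal blocks. The difference has only the two off-diagonal blocks, each of square zero
  (\<open>scalar_on_range_sum_of_three_square_zero\<close>).\<close>

context vector_space
begin

section \<open>Endomorphisms, complements and projections\<close>

lemma endomorphism_iff:
  "endomorphism f \<longleftrightarrow> (\<forall>x y. f (x + y) = f x + f y) \<and> (\<forall>c x. f (c *s x) = c *s f x)"
  unfolding endomorphism_def using linear_iff[of scale scale f] vector_space_axioms by blast

lemma
  assumes "endomorphism f"
  shows endomorphism_add: "f (x + y) = f x + f y"
    and endomorphism_scale: "f (c *s x) = c *s f x"
    and endomorphism_0: "f 0 = 0"
    and endomorphism_diff: "f (x - y) = f x - f y"
    and endomorphism_neg: "f (- x) = - f x"
proof -
  interpret f: Vector_Spaces.linear scale scale f
    using assms by (simp add: endomorphism_def)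
  show "f (x + y) = f x + f y" "f (c *s x) = c *s f x" "f 0 = 0" "f (x - y) = f x - f y"
    "f (- x) = - f x"
    by (simp_all add: f.add f.scale f.diff f.neg)
qed

lemmas endomorphism_simps =
  endomorphism_add endomorphism_scale endomorphism_0 endomorphism_diff endomorphism_neg

lemma endomorphism_compose:
  "endomorphism f \<Longrightarrow> endomorphism g \<Longrightarrow> endomorphism (\<lambda>x. f (g x))"
  by (simp add: endomorphism_iff)

lemma endomorphism_ident: "endomorphism (\<lambda>x. x)"
  and endomorphism_zero: "endomorphism (\<lambda>x. 0)"
  and endomorphism_plus:
    "endomorphism f \<Longrightarrow> endomorphism g \<Longrightarrow> endomorphism (\<lambda>x. f x + g x)"
  and endomorphism_minus:
    "endomorphism f \<Longrightarrow> endomorphism g \<Longrightarrow> endomorphism (\<lambda>x. f x - g x)"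
  and endomorphism_smult: "endomorphism f \<Longrightarrow> endomorphism (\<lambda>x. c *s f x)"
  by (simp_all add: endomorphism_iff algebra_simps)

lemma endomorphism_funpow: "endomorphism f \<Longrightarrow> endomorphism (f ^^ k)"
  by (induction k) (simp_all add: endomorphism_iff)

lemma subspace_image_endomorphism: "endomorphism f \<Longrightarrow> subspace S \<Longrightarrow> subspace (f ` S)"
  unfolding subspace_def 
  by (auto simp: image_iff) (metis endomorphism_0 endomorphism_add endomorphism_scale)+

lemma subspace_preimage:
  "endomorphism f \<Longrightarrow> subspace S \<Longrightarrow> subspace X \<Longrightarrow> subspace {x \<in> S. f x \<in> X}"
  unfolding subspace_def by (auto simp: endomorphism_simps)

lemma endomorphism_extend:
  assumes "independent B"
  obtains f where "endomorphism f" "\<forall>b\<in>B. f b = h b" "range f = span (h ` B)"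
proof -
  interpret P: vector_space_pair scale scale ..
  show thesis
    using P.linear_independent_extend_subspace[OF assms, of h] that
    unfolding endomorphism_def by blast
qed

lemma endomorphism_eq_on_span:
  assumes "endomorphism f" "endomorphism g" "\<And>b. b \<in> B \<Longrightarrow> f b = g b" "x \<in> span B"
  shows "f x = g x"
  using assms(4)
proof (induction rule: span_induct)
  show "subspace {x. f x = g x}"
    using assms(1,2) by (auto simp: subspace_def endomorphism_simps)
qed (use assms(3) in auto)

lemma endomorphism_span_into:
  assumes "endomorphism f" "subspace X" "\<And>b. b \<in> B \<Longrightarrow> f b \<in> X" "x \<in> span B"
  shows "f x \<in> X"
  using assms(4)
proof (induction rule: span_induct)
  show "subspace {x. f x \<in> X}"
    using assms(1,2) by (auto simp: subspace_def endomorphism_simps)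
qed (use assms(3) in auto)

lemma projection_exists:
  assumes "subspace X"
  obtains p where "endomorphism p" "range p = X" "\<forall>x\<in>X. p x = x"
proof -
  obtain A where A: "A \<subseteq> X" "independent A" "X \<subseteq> span A"
    using maximal_independent_subset by blast
  then have X: "X = span A"
    using assms span_minimal by blast
  obtain p where p: "endomorphism p" "\<forall>b\<in>A. p b = b" "range p = span ((\<lambda>b. b) ` A)"
    by (rule endomorphism_extend[OF A(2)])
  have "p x = x" if "x \<in> X" for x
    using endomorphism_eq_on_span[OF p(1) endomorphism_ident, of A] p(2) that X by simp
  then show thesis
    using that[OF p(1)] p(3) X by simp
qed

text \<open>The kernel in \<open>Y\<close> of any projection onto \<open>X\<close> is a complement of \<open>X\<close> in \<open>Y\<close>.\<close>
lemma complement_exists: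
  assumes "subspace X" "subspace Y" "X \<subseteq> Y"
  obtains C where "subspace C" "C \<subseteq> Y" "X \<inter> C = {0}" "\<forall>y\<in>Y. \<exists>x\<in>X. \<exists>c\<in>C. y = x + c"
proof -
  obtain p where p: "endomorphism p" "range p = X" "\<forall>x\<in>X. p x = x"
    by (rule projection_exists[OF assms(1)])
  show thesis
  proof
    show "subspace {y \<in> Y. p y \<in> {0}}"
      by (rule subspace_preimage[OF p(1) assms(2)]) simp
    show "X \<inter> {y \<in> Y. p y \<in> {0}} = {0}"
      using p(3) assms by (auto simp: subspace_0)
    show "\<forall>y\<in>Y. \<exists>x\<in>X. \<exists>c\<in>{y \<in> Y. p y \<in> {0}}. y = x + c"
    proof
      fix y assume y: "y \<in> Y"
      have "p y \<in> X" using p(2) by blast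
      moreover have "y - p y \<in> {y \<in> Y. p y \<in> {0}}"
        using y calculation p assms by (auto simp: endomorphism_simps subspace_diff)
      ultimately show "\<exists>x\<in>X. \<exists>c\<in>{y \<in> Y. p y \<in> {0}}. y = x + c"
        by (intro bexI[of _ "p y"] bexI[of _ "y - p y"]) auto
    qed
  qed auto
qed

lemma projection_along_exists:
  assumes V: "subspace V0" "subspace V1" "V0 \<inter> V1 = {0}"
    and sum: "\<And>v. \<exists>x\<in>V0. \<exists>y\<in>V1. v = x + y"
  obtains p where "endomorphism p" "\<And>v. p v \<in> V0" "\<And>v. v - p v \<in> V1"
    "\<And>v. v \<in> V0 \<Longrightarrow> p v = v" "\<And>v. v \<in> V1 \<Longrightarrow> p v = 0"
proof -
  have "\<exists>x. x \<in> V0 \<and> v - x \<in> V1" for v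
    using sum[of v] by force
  then obtain p where p: "\<And>v. p v \<in> V0" "\<And>v. v - p v \<in> V1"
    by metis
  have eq: "p v = x" if "x \<in> V0" "v - x \<in> V1" for v x
  proof -
    have "x - p v \<in> V0"
      using that(1) p(1) V(1) by (simp add: subspace_diff)
    moreover have "(v - p v) - (v - x) \<in> V1"
      using subspace_diff[OF V(2) p(2) that(2)] .
    ultimately have "x - p v \<in> V0 \<inter> V1" by simp
    then show ?thesis using V(3) by simp
  qed
  show thesis
  proof
    show "endomorphism p"
      unfolding endomorphism_iff
    proof (intro conjI allI)
      fix x y c
      have "(x - p x) + (y - p y) \<in> V1" "c *s (x - p x) \<in> V1"
        using V(2) p(2) by (intro subspace_add subspace_scale; simp)+
      then show "p (x + y) = p x + p y" "p (c *s x) = c *s p x"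
        using V(1) p(1) by (auto intro!: eq subspace_add subspace_scale simp: algebra_simps)
    qed
    show "p v = v" if "v \<in> V0" for v
      using that V by (intro eq) (auto simp: subspace_0)
    show "p v = 0" if "v \<in> V1" for v
      using that V by (intro eq) (auto simp: subspace_0)
  qed (use p in auto)
qed

section \<open>A nilpotent endomorphism is the sum of two square-zero endomorphisms\<close>

text \<open>This is the grading that a Jordan basis would give by colouring the vectors of each chain
  alternately, but it needs neither a basis nor finite dimension. By induction, the image
  \<open>n ` S\<close> splits as \<open>X0 \<oplus> X1\<close> with \<open>n\<close> swapping the summands. The preimages \<open>P0\<close> and \<open>P1\<close> of
  \<open>X0\<close> and \<open>X1\<close> span \<open>S\<close> together and overlap exactly in the kernel \<open>K\<close>. If \<open>X0 \<subseteq> V0 \<subseteq> P1\<close> and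
  \<open>X1 \<subseteq> V1 \<subseteq> P0\<close>, then \<open>n\<close> swaps \<open>V0\<close> and \<open>V1\<close>; so it remains to choose complementary such
  \<open>V0\<close> and \<open>V1\<close>. First \<open>V0\<close> is taken large enough that \<open>V0 + P0 = S\<close>, yet disjoint from
  \<open>X1\<close>; then \<open>X1\<close> can be enlarged inside \<open>P0\<close> to a complement \<open>V1\<close> of \<open>V0\<close>.\<close>

lemma nilpotent_swaps_summands:
  assumes n: "endomorphism n"
  shows "subspace S \<Longrightarrow> n ` S \<subseteq> S \<Longrightarrow> \<forall>x\<in>S. (n ^^ k) x = 0 \<Longrightarrow>
    \<exists>V0 V1. subspace V0 \<and> subspace V1 \<and> V0 \<subseteq> S \<and> V1 \<subseteq> S \<and> V0 \<inter> V1 = {0} \<and>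
      (\<forall>s\<in>S. \<exists>x\<in>V0. \<exists>y\<in>V1. s = x + y) \<and> n ` V0 \<subseteq> V1 \<and> n ` V1 \<subseteq> V0"
proof (induction k arbitrary: S)
  case 0
  then have "S = {0}"
    using subspace_0 by auto
  then show ?case
    using n by (intro exI[of _ "{0}"]) (simp add: endomorphism_0)
next
  case (Suc k)
  have nS: "n x \<in> S" if "x \<in> S" for x
    using that Suc.prems(2) by blast
  have nil: "\<forall>x\<in>n ` S. (n ^^ k) x = 0"
    using Suc.prems(3) by (auto simp: funpow_swap1)
  obtain X0 X1 where X: "subspace X0" "subspace X1" "X0 \<subseteq> n ` S" "X1 \<subseteq> n ` S"
      "X0 \<inter> X1 = {0}" "\<forall>t\<in>n ` S. \<exists>x\<in>X0. \<exists>y\<in>X1. t = x + y"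
      "n ` X0 \<subseteq> X1" "n ` X1 \<subseteq> X0"
    using Suc.IH[OF subspace_image_endomorphism[OF n Suc.prems(1)] image_mono[OF Suc.prems(2)] nil]
    by (elim exE conjE) (rule that)
  define P0 where "P0 = {s \<in> S. n s \<in> X0}"
  define P1 where "P1 = {s \<in> S. n s \<in> X1}"
  have P: "subspace P0" "subspace P1" "P0 \<subseteq> S" "P1 \<subseteq> S" "X1 \<subseteq> P0" "X0 \<subseteq> P1"
    unfolding P0_def P1_def using X nS subspace_preimage[OF n Suc.prems(1)] by auto
  have P01: "\<exists>x\<in>P0. \<exists>y\<in>P1. s = x + y" if s: "s \<in> S" for s
  proof -
    obtain t0 t1 where t: "t0 \<in> X0" "t1 \<in> X1" "n s = t0 + t1"
      using X(6) s by blast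
    obtain s0 where s0: "s0 \<in> S" "n s0 = t0"
      using t(1) X(3) by blast
    have "s0 \<in> P0" "s - s0 \<in> P1"
      using s s0 t n Suc.prems(1) by (auto simp: P0_def P1_def endomorphism_simps subspace_diff)
    then show ?thesis
      by (intro bexI[of _ s0] bexI[of _ "s - s0"]) auto
  qed
  define K where "K = P0 \<inter> P1"
  have K: "subspace K"
    unfolding K_def using P by (simp add: subspace_inter)
  have sumsK: "subspace {x + y |x y. x \<in> X0 \<and> y \<in> K}" (is "subspace ?X0K")
    by (rule subspace_sums[OF X(1) K])
  have le0: "?X0K \<subseteq> P1"
    using P(2,6) by (auto simp: K_def subspace_add subsetD)
  \<comment> \<open>\<open>C1\<close> supplies what \<open>P1\<close> has beyond \<open>X0\<close> and the kernel; \<open>P0\<close> contains the kernel,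
    and so \<open>V0 + P0\<close> will contain \<open>P0 + P1 = S\<close>.\<close>
  obtain C1 where C1: "subspace C1" "C1 \<subseteq> P1" "?X0K \<inter> C1 = {0}"
      "\<forall>y\<in>P1. \<exists>x\<in>?X0K. \<exists>c\<in>C1. y = x + c"
    by (rule complement_exists[OF sumsK P(2) le0])
  define V0 where "V0 = {x + c |x c. x \<in> X0 \<and> c \<in> C1}"
  have V0: "subspace V0" "V0 \<subseteq> P1" "X0 \<subseteq> V0"
  proof -
    show "subspace V0"
      unfolding V0_def by (rule subspace_sums[OF X(1) C1(1)])
    show "V0 \<subseteq> P1"
      unfolding V0_def using P(2,6) C1(2) by (auto simp: subspace_add subsetD)
    show "X0 \<subseteq> V0"
      unfolding V0_def using subspace_0[OF C1(1)] by force
  qed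
  have V0X1: "v = 0" if v: "v \<in> V0" "v \<in> X1" for v
  proof -
    obtain x c where xc: "v = x + c" "x \<in> X0" "c \<in> C1"
      using v(1) unfolding V0_def by blast
    have "v \<in> K"
      using v P(5) V0(2) by (auto simp: K_def)
    then have "c \<in> ?X0K"
      using xc subspace_neg[OF X(1) xc(2)]
      by (intro CollectI exI[of _ "- x"] exI[of _ v]) simp
    then have "c = 0"
      using C1(3) xc(3) by blast
    then show ?thesis
      using xc v(2) X(5) by auto
  qed
  have V0P0: "\<exists>x\<in>V0. \<exists>y\<in>P0. s = x + y" if s: "s \<in> S" for s
  proof -
    obtain s0 s1 where s01: "s0 \<in> P0" "s1 \<in> P1" "s = s0 + s1"
      using P01[OF s] by blast
    obtain x k c where xkc: "x \<in> X0" "k \<in> K" "c \<in> C1" "s1 = x + k + c"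
      using C1(4) s01(2) by blast
    have "x + c \<in> V0" "s0 + k \<in> P0"
      using xkc s01 P(1) by (auto simp: V0_def K_def subspace_add)
    moreover have "s = (x + c) + (s0 + k)"
      using s01 xkc by simp
    ultimately show ?thesis by blast
  qed
  have V0P0_sub: "subspace (V0 \<inter> P0)"
    using V0(1) P(1) by (rule subspace_inter)
  have sums1: "subspace {x + y |x y. x \<in> X1 \<and> y \<in> V0 \<inter> P0}" (is "subspace ?Y")
    by (rule subspace_sums[OF X(2) V0P0_sub])
  have le1: "?Y \<subseteq> P0"
    using P(1,5) by (auto simp: subspace_add subsetD)
  obtain C where C: "subspace C" "C \<subseteq> P0" "?Y \<inter> C = {0}"
      "\<forall>y\<in>P0. \<exists>x\<in>?Y. \<exists>c\<in>C. y = x + c"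
    by (rule complement_exists[OF sums1 P(1) le1])
  define V1 where "V1 = {x + c |x c. x \<in> X1 \<and> c \<in> C}"
  have V1: "subspace V1" "V1 \<subseteq> P0" "X1 \<subseteq> V1"
  proof -
    show "subspace V1"
      unfolding V1_def by (rule subspace_sums[OF X(2) C(1)])
    show "V1 \<subseteq> P0"
      unfolding V1_def using P(1,5) C(2) by (auto simp: subspace_add subsetD)
    show "X1 \<subseteq> V1"
      unfolding V1_def using subspace_0[OF C(1)] by force
  qed
  have V01: "v = 0" if v: "v \<in> V0" "v \<in> V1" for v
  proof -
    obtain x c where xc: "v = x + c" "x \<in> X1" "c \<in> C"
      using v(2) unfolding V1_def by blast
    have "v \<in> V0 \<inter> P0"
      using v V1(2) by auto
    then have "c \<in> ?Y"
      using xc subspace_neg[OF X(2) xc(2)]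
      by (intro CollectI exI[of _ "- x"] exI[of _ v]) simp
    then have "c = 0"
      using C(3) xc(3) by blast
    then show ?thesis
      using xc v(1) V0X1 by auto
  qed
  have sumV: "\<exists>x\<in>V0. \<exists>y\<in>V1. s = x + y" if s: "s \<in> S" for s
  proof -
    obtain v p where vp: "v \<in> V0" "p \<in> P0" "s = v + p"
      using V0P0[OF s] by blast
    obtain x w c where xwc: "x \<in> X1" "w \<in> V0" "c \<in> C" "p = x + w + c"
      using C(4) vp(2) by blast
    have "v + w \<in> V0" "x + c \<in> V1"
      using vp xwc V0(1) by (auto simp: V1_def subspace_add)
    moreover have "s = (v + w) + (x + c)"
      using vp xwc by simp
    ultimately show ?thesis by blast
  qed
  have "n ` V0 \<subseteq> V1" "n ` V1 \<subseteq> V0"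
    using V0 V1 by (auto simp: P0_def P1_def)
  moreover have "V0 \<inter> V1 = {0}"
    using V01 V0(1) V1(1) by (auto simp: subspace_0)
  moreover have "V0 \<subseteq> S" "V1 \<subseteq> S"
    using V0(2) V1(2) P(3,4) by blast+
  moreover have "\<forall>s\<in>S. \<exists>x\<in>V0. \<exists>y\<in>V1. s = x + y"
    by (rule ballI) (rule sumV)
  ultimately show ?case
    using V0(1) V1(1) by (intro exI[of _ V0] exI[of _ V1] conjI)
qed

text \<open>If \<open>n\<close> swaps the summands of \<open>V0 \<oplus> V1\<close>, then its restriction to either summand, extended by
  zero to the other one, has square zero.\<close>
lemma nilpotent_sum_of_two_square_zero:
  assumes n: "endomorphism n" and nil: "\<And>x. (n ^^ k) x = 0"
  obtains a b where "square_zero a" "square_zero b" "\<And>x. n x = a x + b x"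
proof -
  obtain V0 V1 where V: "subspace V0" "subspace V1" "V0 \<inter> V1 = {0}"
      "\<And>s. \<exists>x\<in>V0. \<exists>y\<in>V1. s = x + y" "n ` V0 \<subseteq> V1" "n ` V1 \<subseteq> V0"
    using nilpotent_swaps_summands[OF n subspace_UNIV, of k] nil by auto
  obtain p where p: "endomorphism p" "\<And>v. p v \<in> V0" "\<And>v. v - p v \<in> V1"
      "\<And>v. v \<in> V0 \<Longrightarrow> p v = v" "\<And>v. v \<in> V1 \<Longrightarrow> p v = 0"
    using projection_along_exists[OF V(1-4)] by metis
  have z: "p (n (p v)) = 0" "p (n (v - p v)) = n (v - p v)" for v
    using p V(5,6) by blast+
  show thesis
  proof
    show "square_zero (\<lambda>v. n (p v))"
      using endomorphism_compose[OF n p(1)] z(1) endomorphism_0[OF n]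
      by (simp add: square_zero_def fun_eq_iff)
    show "square_zero (\<lambda>v. n (v - p v))"
      using endomorphism_compose[OF n endomorphism_minus[OF endomorphism_ident p(1)]] z(2)
        endomorphism_0[OF n]
      by (simp add: square_zero_def fun_eq_iff)
    show "n v = n (p v) + n (v - p v)" for v
      using endomorphism_add[OF n, of "p v" "v - p v"] by simp
  qed
qed

section \<open>A trace-zero endomorphism as the sum of two nilpotent ones\<close>

lemma independent_pair:
  assumes B: "independent B" "b \<in> B" "c \<in> B" "b \<noteq> c" and eq: "s *s b = t *s c"
  shows "s = 0" "t = 0"
proof -
  have "representation B (s *s b) b = s" "representation B (t *s c) b = 0"
    using B by (simp_all add: representation_scale representation_basis span_base)
  then show s: "s = 0"
    using eq by simp
  have "c \<noteq> 0"
    using B dependent_zero by blast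
  then show "t = 0"
    using eq s by simp
qed

lemma scalar_if_all_eigenvectors:
  assumes A: "endomorphism A" and B: "independent B"
    and eig: "\<And>v. v \<in> span B \<Longrightarrow> A v \<in> span {v}"
  shows "\<exists>\<mu>. \<forall>v\<in>span B. A v = \<mu> *s v"
proof (cases "B = {}")
  case True
  then show ?thesis
    using endomorphism_0[OF A] by simp
next
  case False
  then obtain b0 where b0: "b0 \<in> B" by blast
  obtain m where m: "\<And>v. v \<in> span B \<Longrightarrow> A v = m v *s v"
    using eig unfolding span_singleton by (simp add: image_iff) metis
  have eq: "A b = m b0 *s b" if b: "b \<in> B" for b
  proof (cases "b = b0")
    case False
    have sp: "b \<in> span B" "b0 \<in> span B" "b + b0 \<in> span B"
      using b b0 by (simp_all add: span_base span_add)
    have "m (b + b0) *s b + m (b + b0) *s b0 = m b *s b + m b0 *s b0"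
      using m[OF sp(1)] m[OF sp(2)] m[OF sp(3)] endomorphism_add[OF A, of b b0]
      by (simp add: scale_right_distrib)
    then have "(m (b + b0) - m b) *s b = (m b0 - m (b + b0)) *s b0"
      by (simp add: scale_left_diff_distrib algebra_simps)
    from independent_pair[OF B b b0 False this] show ?thesis
      using m[OF sp(1)] by simp
  qed (use b m span_base in simp)
  show ?thesis
    using endomorphism_eq_on_span[OF A endomorphism_smult[OF endomorphism_ident] eq] by blast
qed

lemma independent_exchange_diff:
  assumes B: "independent B" "x \<in> B" "w \<in> B" "w \<noteq> x"
  shows "independent (insert (w - x) (B - {w}))" "span (insert (w - x) (B - {w})) = span B"
    "w - x \<notin> B - {w}"
proof -
  have x: "x \<in> span (B - {w})"
    using B by (simp add: span_base)
  have w: "w \<notin> span (B - {w})"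
    using B by (auto simp: dependent_def)
  have "w - x \<notin> span (B - {w})"
    using w x span_add[of "w - x" "B - {w}" x] by auto
  then show "independent (insert (w - x) (B - {w}))" "w - x \<notin> B - {w}"
    using independent_insertI[OF _ independent_mono[OF B(1)]] by (blast intro: span_base)+
  have "(w - x) + x \<in> span (insert (w - x) (B - {w}))"
    using B(2,4) by (intro span_add span_base) auto
  then have "w \<in> span (insert (w - x) (B - {w}))"
    by simp
  moreover have "w - x \<in> span B"
    using B by (simp add: span_base span_diff)
  ultimately show "span (insert (w - x) (B - {w})) = span B"
    unfolding span_eq using B by (auto intro: span_base)
qed

lemma coordinate_projection_exists:
  assumes B: "independent B" "x \<in> B"
  obtains \<pi> where "endomorphism \<pi>" "\<pi> x = x" "\<forall>v. \<pi> v \<in> span {x}"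
    "\<forall>v\<in>span (B - {x}). \<pi> v = 0" "\<forall>v\<in>span B. v - \<pi> v \<in> span (B - {x})"
proof -
  obtain p where p: "endomorphism p" "\<forall>b\<in>B. p b = (if b = x then x else 0)"
      "range p = span ((\<lambda>b. if b = x then x else 0) ` B)"
    by (rule endomorphism_extend[OF B(1)])
  have "span ((\<lambda>b. if b = x then x else 0) ` B) \<subseteq> span (insert 0 {x})"
    by (rule span_mono) auto
  then have r: "\<forall>v. p v \<in> span {x}"
    using p(3) by (metis rangeI span_insert_0 subsetD)
  have z: "\<forall>v\<in>span (B - {x}). p v = 0"
    using endomorphism_eq_on_span[OF p(1) endomorphism_zero, of "B - {x}"] p(2) by simp
  have "\<forall>v\<in>span B. v - p v \<in> span (B - {x})"
    using endomorphism_span_into[OF endomorphism_minus[OF endomorphism_ident p(1)]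
        subspace_span[of "B - {x}"], of B] p(2)
    by (simp add: span_zero span_base)
  then show thesis
    using p(1,2) B(2) r z by (intro that[of p]) auto
qed

text \<open>The inductive step for the splitting into nilpotents removes a vector \<open>x\<close> from a basis, and
  replaces \<open>A\<close> by its compression to the span of the others along \<open>x\<close>. The vector \<open>A x\<close> must lie
  in that span, so that the trace survives, and the compression must not be a nonzero
  scalar, which has no splitting. Any \<open>x\<close> that is no eigenvector, completed to a basis that contains
  \<open>y = A x\<close>, meets the first condition. Suppose that the compression is then a scalar
  \<open>\<mu> \<noteq> 0\<close>. As the trace vanishes, the basis has a third vector \<open>w\<close>. Replacing \<open>w\<close> by
  \<open>w - x\<close> tilts the complement of \<open>x\<close>: modulo \<open>x\<close>, the vector \<open>w - x\<close> now goes to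
  \<open>\<mu> (w - x) - y\<close>, which is no multiple of it.\<close>
lemma nonscalar_compression_exists:
  assumes A: "endomorphism A" and B: "finite B" "independent B" and inv: "A ` span B \<subseteq> span B"
    and tr: "(\<Sum>b\<in>B. representation B (A b) b) = 0"
    and ns: "\<nexists>\<mu>. \<forall>v\<in>span B. A v = \<mu> *s v"
  obtains C x where "finite C" "independent C" "span C = span B" "x \<in> C" "A x \<in> span (C - {x})"
    "\<forall>\<mu>. (\<forall>v\<in>span (C - {x}). A v - \<mu> *s v \<in> span {x}) \<longrightarrow> \<mu> = 0"
proof -
  obtain x where x: "x \<in> span B" "A x \<notin> span {x}"
    using scalar_if_all_eigenvectors[OF A B(2)] ns by blast
  define y where "y = A x"
  have xy: "x \<noteq> 0" "y \<noteq> x" "y \<in> span B"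
    using x inv endomorphism_0[OF A] by (auto simp: y_def span_base span_zero)
  have "independent {y, x}"
    using x xy independent_insertI[of y "{x}"] by (simp add: y_def)
  moreover have "{y, x} \<subseteq> span B"
    using x xy by simp
  moreover have "finite_dim_subspace (span B)"
    using B by (auto simp: finite_dim_subspace_def)
  ultimately obtain C where C: "{y, x} \<subseteq> C" "finite C" "independent C" "span C = span B"
    using finite_dim_subspace_basis by blast
  have yC: "y \<in> C - {x}"
    using C(1) xy(2) by simp
  show thesis
  proof (cases "\<exists>\<mu>. \<mu> \<noteq> 0 \<and> (\<forall>v\<in>span (C - {x}). A v - \<mu> *s v \<in> span {x})")
    case False
    have 1: "A x \<in> span (C - {x})"
      using span_base[OF yC] by (simp only: y_def)
    have 2: "\<forall>\<mu>. (\<forall>v\<in>span (C - {x}). A v - \<mu> *s v \<in> span {x}) \<longrightarrow> \<mu> = 0"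
      using False by blast
    have 3: "x \<in> C"
      using C(1) by simp
    show thesis
      by (rule that[OF C(2-4) 3 1 2])
  next
    case True
    then obtain \<mu> where mu: "\<mu> \<noteq> 0" "\<forall>v\<in>C - {x}. A v - \<mu> *s v \<in> span {x}"
      using span_base by meson
    have A_eq: "\<exists>t. A v = \<mu> *s v + t *s x" if v: "v \<in> C - {x}" for v
    proof -
      obtain t where "A v - \<mu> *s v = t *s x"
        using mu(2) v unfolding span_singleton by blast
      then have "A v = \<mu> *s v + t *s x"
        by (simp add: algebra_simps)
      then show ?thesis ..
    qed
    have "C \<noteq> {y, x}"
    proof
      assume Cyx: "C = {y, x}"
      have tr': "representation C (A y) y + representation C (A x) x = 0"
        using trace_basis_change[of A C B] A B C inv tr xy(2) Cyx
        by (simp add: endomorphism_def)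
      obtain t where t: "A y = \<mu> *s y + t *s x"
        using A_eq[OF yC] by blast
      have "representation C (A x) x = 0"
        unfolding y_def[symmetric] using representation_basis[OF C(3)] yC by auto
      moreover have "representation C (A y) y = \<mu>"
        using C(1,3) xy(2) unfolding t
        by (simp add: representation_add representation_scale representation_basis span_base span_scale)
      ultimately show False
        using tr' mu(1) by simp
    qed
    then obtain w where w: "w \<in> C" "w \<noteq> x" "w \<noteq> y"
      using C(1) by blast
    define D where "D = insert (w - x) (C - {w})"
    have xC: "x \<in> C" using C(1) by simp
    note D = independent_exchange_diff[OF C(3) xC w(1,2), folded D_def]
    have xyD: "x \<in> D" "y \<in> D - {x}" "w - x \<in> D" "w - x \<noteq> x" "w - x \<noteq> y"
      using D(3) xC yC w by (auto simp: D_def)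
    show thesis
    proof (rule that[of D x])
      show "finite D" "independent D" "span D = span B" "x \<in> D" "A x \<in> span (D - {x})"
        using C D xyD by (simp_all add: D_def[symmetric] y_def[symmetric] span_base)
          (simp add: D_def)
      show "\<forall>\<nu>. (\<forall>v\<in>span (D - {x}). A v - \<nu> *s v \<in> span {x}) \<longrightarrow> \<nu> = 0"
      proof (intro allI impI)
        fix \<nu> assume nu: "\<forall>v\<in>span (D - {x}). A v - \<nu> *s v \<in> span {x}"
        obtain t where t: "A w = \<mu> *s w + t *s x"
          using A_eq w by blast
        have "w - x \<in> span (D - {x})"
          using xyD by (simp add: span_base)
        with nu have "A (w - x) - \<nu> *s (w - x) \<in> span {x}"
          by blast
        then obtain s where s: "A (w - x) - \<nu> *s (w - x) = s *s x"
          unfolding span_singleton by blast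
        have "A (w - x) = \<mu> *s (w - x) + (\<mu> + t) *s x - y"
          using t endomorphism_diff[OF A] by (simp add: y_def algebra_simps)
        with s have eq: "y = (\<mu> - \<nu>) *s (w - x) + (\<mu> + t - s) *s x"
          by (simp add: algebra_simps)
        have "representation D y y = 1"
          using representation_basis[OF D(1)] xyD by simp
        moreover have "representation D y y = 0"
          by (subst eq) (use xyD D(1) in \<open>simp add: representation_add representation_scale
              representation_basis span_base span_scale\<close>)
        ultimately have False by simp
        then show "\<nu> = 0" ..
      qed
    qed
  qed
qed

lemma trace_of_compression:
  assumes C: "finite C" "independent C" "x \<in> C" and Ax: "A x \<in> span (C - {x})"
    and \<pi>: "\<forall>v. \<pi> v \<in> span {x}"
    and comp: "\<forall>v\<in>span C. A v - \<pi> (A v) \<in> span (C - {x})" and inv: "A ` span C \<subseteq> span C"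
  shows "(\<Sum>b\<in>C - {x}. representation (C - {x}) (A b - \<pi> (A b)) b)
    = (\<Sum>b\<in>C. representation C (A b) b)"
proof -
  have x: "representation C (A x) x = 0"
    using representation_extend[OF C(2) Ax] representation_ne_zero[of "C - {x}" "A x" x] by auto
  have "representation (C - {x}) (A b - \<pi> (A b)) b = representation C (A b) b"
    if b: "b \<in> C - {x}" for b
  proof -
    have bC: "b \<in> span C" "A b \<in> span C"
      using b inv by (auto simp: span_base)
    obtain t where t: "\<pi> (A b) = t *s x"
      using \<pi> unfolding span_singleton by blast
    have "representation (C - {x}) (A b - \<pi> (A b)) b = representation C (A b - \<pi> (A b)) b"
      using representation_extend[OF C(2), of "A b - \<pi> (A b)" "C - {x}"] comp bC(1) by auto
    also have "\<dots> = representation C (A b) b"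
      unfolding t using b bC C
      by (simp add: representation_diff representation_scale representation_basis span_base span_scale)
    finally show ?thesis .
  qed
  then have "(\<Sum>b\<in>C - {x}. representation (C - {x}) (A b - \<pi> (A b)) b)
      = (\<Sum>b\<in>C - {x}. representation C (A b) b)"
    by simp
  also have "\<dots> = (\<Sum>b\<in>C. representation C (A b) b)"
    using C x by (simp add: sum.remove)
  finally show ?thesis .
qed

definition nilpotent_on :: "'b set \<Rightarrow> ('b \<Rightarrow> 'b) \<Rightarrow> bool" where
  "nilpotent_on W f \<longleftrightarrow> endomorphism f \<and> f ` W \<subseteq> W \<and> (\<exists>k. \<forall>v\<in>W. (f ^^ k) v = 0)"

lemma nilpotent_on_funpow_in: "nilpotent_on W f \<Longrightarrow> v \<in> W \<Longrightarrow> (f ^^ k) v \<in> W"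
  by (induction k) (auto simp: nilpotent_on_def)

lemma funpow_zero_mono:
  assumes "endomorphism f" "(f ^^ k) v = 0" "k \<le> m"
  shows "(f ^^ m) v = 0"
proof -
  have "(f ^^ m) v = (f ^^ (m - k)) ((f ^^ k) v)"
    using assms(3) by (metis comp_apply funpow_add le_add_diff_inverse2)
  then show ?thesis
    using assms endomorphism_0[OF endomorphism_funpow[OF assms(1)]] by simp
qed

text \<open>With respect to the decomposition into \<open>span {x}\<close> and \<open>span (C - {x})\<close>, the matrix of \<open>A\<close> has
  the corner entry zero at \<open>x\<close>. Its column below that corner is added to \<open>L\<close>, which becomes block lower
  triangular, and its row beside it to \<open>U\<close>, which becomes block upper triangular; both keep
  nilpotent diagonal blocks.\<close>
lemma nilpotent_splitting_lift:
  assumes A: "endomorphism A" and C: "independent C" "x \<in> C" and inv: "A ` span C \<subseteq> span C"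
    and Ax: "A x \<in> span (C - {x})"
    and \<pi>: "endomorphism \<pi>" "\<pi> x = x" "\<forall>v. \<pi> v \<in> span {x}" "\<forall>v\<in>span (C - {x}). \<pi> v = 0"
      "\<forall>v\<in>span C. v - \<pi> v \<in> span (C - {x})"
    and L: "nilpotent_on (span (C - {x})) L" and U: "nilpotent_on (span (C - {x})) U"
    and eq: "\<forall>v\<in>span (C - {x}). A v - \<pi> (A v) = L v + U v"
  shows "\<exists>L U. nilpotent_on (span C) L \<and> nilpotent_on (span C) U \<and> (\<forall>v\<in>span C. A v = L v + U v)"
proof -
  let ?W = "span (C - {x})"
  have WC: "?W \<subseteq> span C"
    by (rule span_mono) auto
  have xC: "span {x} \<subseteq> span C"
    using C by (intro span_mono) auto
  have Le: "endomorphism L" and Ue: "endomorphism U"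
    using L U by (simp_all add: nilpotent_on_def)
  have LW: "L v \<in> ?W" "U v \<in> ?W" if "v \<in> ?W" for v
    using that L U by (auto simp: nilpotent_on_def)
  obtain k where k: "\<forall>v\<in>?W. (L ^^ k) v = 0"
    using L by (auto simp: nilpotent_on_def)
  obtain m where m: "\<forall>v\<in>?W. (U ^^ m) v = 0"
    using U by (auto simp: nilpotent_on_def)
  have on_x: "\<pi> v = v" "A v \<in> ?W" if "v \<in> span {x}" for v
    using that \<pi>(2) Ax endomorphism_scale[OF \<pi>(1)] endomorphism_scale[OF A]
    by (auto simp: span_singleton span_scale)
  define L' where "L' = (\<lambda>v. L (v - \<pi> v) + A (\<pi> v))"
  define U' where "U' = (\<lambda>v. U (v - \<pi> v) + \<pi> (A (v - \<pi> v)))"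
  have m': "endomorphism (\<lambda>v. v - \<pi> v)"
    by (rule endomorphism_minus[OF endomorphism_ident \<pi>(1)])
  have L'e: "endomorphism L'" and U'e: "endomorphism U'"
    unfolding L'_def U'_def
    by (intro endomorphism_plus endomorphism_compose[OF Le m'] endomorphism_compose[OF A \<pi>(1)]
      endomorphism_compose[OF Ue m'] endomorphism_compose[OF \<pi>(1) endomorphism_compose[OF A m']])+
  have L'W: "L' v \<in> ?W" if "v \<in> span C" for v
    unfolding L'_def using that \<pi>(3,5) LW on_x by (auto intro!: span_add)
  have U'C: "U' v \<in> span C" if "v \<in> span C" for v
    unfolding U'_def using that \<pi>(3,5) LW WC xC by (blast intro: span_add)
  have L'_eq: "(L' ^^ j) v = (L ^^ j) v" if v: "v \<in> ?W" for v j
  proof (induction j)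
    case (Suc j)
    then show ?case
      using \<pi>(4) nilpotent_on_funpow_in[OF L v, of j] endomorphism_0[OF A] by (simp add: L'_def)
  qed simp
  have "\<forall>v\<in>span C. (L' ^^ Suc k) v = 0"
    using L'W L'_eq k by (simp add: funpow_swap1 del: funpow.simps(2) add: funpow_Suc_right)
  then have 1: "nilpotent_on (span C) L'"
    using L'e L'W WC unfolding nilpotent_on_def by blast
  have U'_pow: "(U' ^^ j) v - \<pi> ((U' ^^ j) v) = (U ^^ j) (v - \<pi> v)" if v: "v \<in> span C" for v j
  proof (induction j)
    case (Suc j)
    let ?z = "(U ^^ j) (v - \<pi> v)"
    have "U' ((U' ^^ j) v) = U ?z + \<pi> (A ?z)"
      using Suc by (simp add: U'_def)
    moreover have "U ?z \<in> ?W"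
      using nilpotent_on_funpow_in[OF U, of "v - \<pi> v" "Suc j"] v \<pi>(5) by simp
    ultimately show ?case
      using \<pi>(3,4) on_x endomorphism_add[OF \<pi>(1)] by simp
  qed simp
  have "(U' ^^ Suc m) v = 0" if v: "v \<in> span C" for v
  proof -
    have "v - \<pi> v \<in> ?W"
      using v \<pi>(5) by blast
    then have "(U ^^ m) (v - \<pi> v) = 0"
      using m by blast
    then have "(U' ^^ m) v - \<pi> ((U' ^^ m) v) = 0"
      using U'_pow[OF v] by simp
    then have "U' ((U' ^^ m) v) = U 0 + \<pi> (A 0)"
      unfolding U'_def by simp
    then show ?thesis
      using endomorphism_0[OF Ue] endomorphism_0[OF A] endomorphism_0[OF \<pi>(1)] by simp
  qed
  then have 2: "nilpotent_on (span C) U'"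
    using U'e U'C unfolding nilpotent_on_def by blast
  have "A v = L' v + U' v" if v: "v \<in> span C" for v
  proof -
    have "v - \<pi> v \<in> ?W"
      using v \<pi>(5) by blast
    then have "A (v - \<pi> v) - \<pi> (A (v - \<pi> v)) = L (v - \<pi> v) + U (v - \<pi> v)"
      using eq by blast
    then have "L (v - \<pi> v) = A (v - \<pi> v) - \<pi> (A (v - \<pi> v)) - U (v - \<pi> v)"
      by simp
    then show ?thesis
      using endomorphism_diff[OF A, of v "\<pi> v"] by (simp add: L'_def U'_def)
  qed
  with 1 2 show ?thesis by blast
qed

text \<open>In matrix terms: unless it is a nonzero scalar, a trace-zero matrix is similar to one with zero
  diagonal, hence to the sum of a strictly lower and a strictly upper triangular matrix. The scalars
  \<open>\<mu> \<noteq> 0\<close> whose trace vanishes in positive characteristic have to be excluded, since \<open>\<mu> - L\<close> is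
  invertible for nilpotent \<open>L\<close>.\<close>
lemma trace_zero_sum_of_two_nilpotents:
  assumes A: "endomorphism A"
  shows "finite B \<Longrightarrow> independent B \<Longrightarrow> A ` span B \<subseteq> span B \<Longrightarrow>
    (\<Sum>b\<in>B. representation B (A b) b) = 0 \<Longrightarrow>
    \<forall>\<mu>. (\<forall>v\<in>span B. A v = \<mu> *s v) \<longrightarrow> (\<forall>v\<in>span B. A v = 0) \<Longrightarrow>
    \<exists>L U. nilpotent_on (span B) L \<and> nilpotent_on (span B) U \<and> (\<forall>v\<in>span B. A v = L v + U v)"
  using A
proof (induction "card B" arbitrary: A B rule: less_induct)
  case less
  note A = less.prems(6)
  show ?case
  proof (cases "\<exists>\<mu>. \<forall>v\<in>span B. A v = \<mu> *s v")
    case True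
    then have "\<forall>v\<in>span B. A v = 0"
      using less.prems(5) by blast
    then show ?thesis
      by (intro exI[of _ "\<lambda>v. 0"])
        (auto simp: nilpotent_on_def endomorphism_zero span_zero intro!: exI[of _ 1])
  next
    case False
    then obtain C x where C: "finite C" "independent C" "span C = span B" "x \<in> C"
        "A x \<in> span (C - {x})"
        "\<forall>\<mu>. (\<forall>v\<in>span (C - {x}). A v - \<mu> *s v \<in> span {x}) \<longrightarrow> \<mu> = 0"
      by (rule nonscalar_compression_exists[OF A less.prems(1-4)])
    obtain \<pi> where \<pi>: "endomorphism \<pi>" "\<pi> x = x" "\<forall>v. \<pi> v \<in> span {x}"
        "\<forall>v\<in>span (C - {x}). \<pi> v = 0" "\<forall>v\<in>span C. v - \<pi> v \<in> span (C - {x})"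
      by (rule coordinate_projection_exists[OF C(2,4)])
    have inv: "A ` span C \<subseteq> span C"
      using less.prems(3) C(3) by simp
    have comp: "\<forall>v\<in>span C. A v - \<pi> (A v) \<in> span (C - {x})"
      using \<pi>(5) inv by blast
    have WC: "span (C - {x}) \<subseteq> span C"
      by (rule span_mono) auto
    have "card C = card B"
      using dim_eq_card_independent[OF C(2)] dim_eq_card_independent[OF less.prems(2)] C(3)
        span_eq_dim[of C B] by simp
    then have card: "card (C - {x}) < card B"
      using card_Diff1_less[OF C(1,4)] by simp
    let ?A = "\<lambda>v. A v - \<pi> (A v)"
    have tr: "(\<Sum>b\<in>C - {x}. representation (C - {x}) (?A b) b) = 0"
      using trace_of_compression[OF C(1,2,4,5) \<pi>(3) comp inv] less.prems(4)
        trace_basis_change[of A C B] A C less.prems(1,2) inv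
      by (simp add: endomorphism_def)
    have ns: "\<forall>\<mu>. (\<forall>v\<in>span (C - {x}). ?A v = \<mu> *s v) \<longrightarrow> (\<forall>v\<in>span (C - {x}). ?A v = 0)"
    proof (intro allI impI)
      fix \<mu> assume mu: "\<forall>v\<in>span (C - {x}). ?A v = \<mu> *s v"
      have "A v - \<mu> *s v = \<pi> (A v)" if "v \<in> span (C - {x})" for v
      proof -
        have "A v - \<pi> (A v) = \<mu> *s v"
          using mu that by blast
        then show ?thesis by (simp add: algebra_simps)
      qed
      then have "\<mu> = 0"
        using C(6) \<pi>(3) by simp
      then show "\<forall>v\<in>span (C - {x}). ?A v = 0"
        using mu by simp
    qed
    have "\<exists>L U. nilpotent_on (span (C - {x})) L \<and> nilpotent_on (span (C - {x})) U \<and>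
        (\<forall>v\<in>span (C - {x}). ?A v = L v + U v)"
    proof (rule less.hyps[OF card _ _ _ tr ns])
      show "finite (C - {x})" "independent (C - {x})"
        using C(1) independent_mono[OF C(2)] by blast+
      show "?A ` span (C - {x}) \<subseteq> span (C - {x})"
        using comp WC by blast
      show "endomorphism ?A"
        by (rule endomorphism_minus[OF A endomorphism_compose[OF \<pi>(1) A]])
    qed
    then show ?thesis
      using nilpotent_splitting_lift[OF A C(2,4) inv C(5) \<pi>] unfolding C(3) by blast
  qed
qed

section \<open>Room in an infinite-dimensional space\<close>

text \<open>The kernel of \<open>u\<close> has finite codimension, so it is infinite-dimensional even modulo the span of
  \<open>F\<close>. Hence it contains an isomorphic copy, under \<open>\<kappa>\<close>, of the range of \<open>u\<close> that is
  independent of \<open>F\<close>; the map \<open>p\<close> reads off the coordinate along this copy.\<close>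

lemma kernel_copy_exists:
  assumes inf: "\<And>S. finite S \<Longrightarrow> span S \<noteq> UNIV"
    and u: "endomorphism u" and B: "finite B" "independent B" "range u = span B"
    and F: "finite F"
  obtains \<kappa> p where "endomorphism \<kappa>" "endomorphism p" "\<forall>v. u (\<kappa> v) = 0" "\<forall>v. p v \<in> span B"
    "\<forall>w\<in>span B. p (\<kappa> w) = w" "\<forall>v\<in>span F. p v = 0"
proof -
  define K where "K = {v. u v = 0}"
  have K: "subspace K"
    using u by (auto simp: K_def subspace_def endomorphism_add endomorphism_0 endomorphism_scale)
  obtain C0 where C0: "C0 \<subseteq> F" "independent C0" "F \<subseteq> span C0"
    using maximal_independent_subset by blast
  have finC0: "finite C0"
    using C0(1) F finite_subset by blast
  obtain C where C: "C0 \<subseteq> C" "C \<subseteq> C0 \<union> K" "independent C" "C0 \<union> K \<subseteq> span C"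
    using maximal_independent_subset_extend[of C0 "C0 \<union> K"] C0(2) by blast
  \<comment> \<open>The span of \<open>C\<close> contains the kernel, so \<open>C\<close> and finitely many preimages of \<open>B\<close>
    together span the whole space.\<close>
  have inf': "infinite (C - C0)"
  proof
    assume "finite (C - C0)"
    then have finC: "finite C"
      using finC0 C(1) by (metis Diff_partition finite_Un)
    have "b \<in> range u" if "b \<in> B" for b
      using B(3) span_base[OF that] by simp
    then have "\<forall>b\<in>B. \<exists>x. u x = b"
      by blast
    then obtain h where h: "\<forall>b\<in>B. u (h b) = b"
      by metis
    have "v \<in> span (C \<union> h ` B)" for v
    proof -
      obtain g where g: "endomorphism g" "\<forall>b\<in>B. g b = h b" "range g = span (h ` B)"
        by (rule endomorphism_extend[OF B(2)])
      have "u (g w) = w" if "w \<in> span B" for w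
        using endomorphism_eq_on_span[OF endomorphism_compose[OF u g(1)] endomorphism_ident, of B w]
          g(2) h that by simp
      then have "u (g (u v)) = u v"
        using B(3) by blast
      then have "u (v - g (u v)) = 0"
        by (simp add: endomorphism_diff[OF u])
      then have "v - g (u v) \<in> span C"
        using C(4) by (auto simp: K_def)
      moreover have "g (u v) \<in> span (h ` B)"
        using g(3) by blast
      ultimately show ?thesis
        unfolding span_Un by (intro CollectI exI[of _ "v - g (u v)"] exI[of _ "g (u v)"]) simp
    qed
    then have "span (C \<union> h ` B) = UNIV" by blast
    then show False
      using inf[of "C \<union> h ` B"] finC B(1) by simp
  qed
  obtain D where D: "D \<subseteq> C - C0" "finite D" "card D = card B"
    using infinite_arbitrarily_large[OF inf', of "card B"] by blast
  obtain e where e: "bij_betw e B D"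
    using finite_same_card_bij[OF B(1) D(2)] D(3) by auto
  obtain \<kappa> where \<kappa>: "endomorphism \<kappa>" "\<forall>b\<in>B. \<kappa> b = e b" "range \<kappa> = span (e ` B)"
    by (rule endomorphism_extend[OF B(2)])
  let ?h = "\<lambda>c. if c \<in> D then inv_into B e c else 0"
  obtain p where p: "endomorphism p" "\<forall>c\<in>C. p c = ?h c" "range p = span (?h ` C)"
    by (rule endomorphism_extend[OF C(3)])
  have eD: "e b \<in> D" "inv_into B e (e b) = b" if "b \<in> B" for b
    using e that by (auto simp: bij_betw_def)
  have inv: "inv_into B e c \<in> B" if "c \<in> D" for c
    using e that by (auto simp: bij_betw_def inv_into_into)
  show thesis
  proof (rule that[OF \<kappa>(1) p(1)])
    have "D \<subseteq> K"
      using D(1) C(2) by blast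
    then have "span (e ` B) \<subseteq> K"
      using e K by (intro span_minimal) (auto simp: bij_betw_def)
    then show "\<forall>v. u (\<kappa> v) = 0"
      using \<kappa>(3) by (auto simp: K_def)
    have "span (?h ` C) \<subseteq> span B"
      using inv by (intro span_minimal) (auto simp: span_zero span_base)
    then show "\<forall>v. p v \<in> span B"
      using p(3) by blast
    have "p (\<kappa> b) = b" if "b \<in> B" for b
      using \<kappa>(2) p(2) eD[OF that] D(1) that by auto
    then show "\<forall>w\<in>span B. p (\<kappa> w) = w"
      using endomorphism_eq_on_span[OF endomorphism_compose[OF p(1) \<kappa>(1)] endomorphism_ident, of B]
      by simp
    have C0p: "p c = 0" if "c \<in> C0" for c
    proof -
      have "c \<in> C" "c \<notin> D"
        using that C(1) D(1) by blast+
      then show ?thesis using p(2) by simp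
    qed
    have F_le: "span F \<subseteq> span C0"
      by (rule span_minimal[OF C0(3) subspace_span])
    have "p v = 0" if "v \<in> span C0" for v
      using endomorphism_eq_on_span[OF p(1) endomorphism_zero C0p that] .
    then show "\<forall>v\<in>span F. p v = 0"
      using F_le by (simp add: subset_iff)
  qed
qed

section \<open>The range of \<open>u\<close> splits into nilpotents\<close>

text \<open>Let \<open>W\<close> be the range of \<open>u\<close>. As \<open>u\<close> maps onto \<open>W\<close>, there is \<open>g\<close> with \<open>u g = U\<close> on \<open>W\<close>, and adding
  a copy of \<open>W\<close> in the kernel makes \<open>\<phi> = g + \<kappa>\<close> an embedding whose image is independent
  of \<open>W\<close>. On \<open>W \<oplus> \<phi> W\<close>, the endomorphism \<open>u\<close> has the block rows \<open>(L + U, U)\<close> and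
  \<open>(0, 0)\<close>. The endomorphism \<open>c\<close> with rows \<open>(U, U)\<close> and \<open>(-U, -U)\<close> has square zero, and
  \<open>u - c\<close> has rows \<open>(L, 0)\<close> and \<open>(U, U)\<close>: it is block triangular with nilpotent diagonal
  blocks. Since \<open>u - c\<close> maps the whole space into \<open>W \<oplus> \<phi> W\<close>, it is nilpotent everywhere.\<close>

lemma square_zero_plus_nilpotent:
  assumes inf: "\<And>S. finite S \<Longrightarrow> span S \<noteq> UNIV"
    and u: "endomorphism u" and B: "finite B" "independent B" "range u = span B"
    and L: "nilpotent_on (span B) L" and U: "nilpotent_on (span B) U"
    and eq: "\<forall>v\<in>span B. u v = L v + U v"
  obtains c k where "square_zero c" "\<forall>v. ((\<lambda>v. u v - c v) ^^ k) v = 0"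
proof -
  let ?W = "span B"
  have Le: "endomorphism L" and Ue: "endomorphism U"
    using L U by (simp_all add: nilpotent_on_def)
  have inW: "L v \<in> ?W" "U v \<in> ?W" if "v \<in> ?W" for v
    using that L U by (auto simp: nilpotent_on_def)
  have uW: "u v \<in> ?W" for v
    using B(3) by blast
  have "U b \<in> range u" if "b \<in> B" for b
    using inW(2)[OF span_base[OF that]] B(3) by simp
  then have "\<forall>b\<in>B. \<exists>x. u x = U b"
    by (metis imageE)
  then obtain h where h: "\<forall>b\<in>B. u (h b) = U b"
    by metis
  obtain g where g: "endomorphism g" "\<forall>b\<in>B. g b = h b" "range g = span (h ` B)"
    by (rule endomorphism_extend[OF B(2)])
  have ug: "u (g w) = U w" if "w \<in> ?W" for w
    using endomorphism_eq_on_span[OF endomorphism_compose[OF u g(1)] Ue, of B w] g(2) h that by simp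
  have fin: "finite (B \<union> h ` B)"
    using B(1) by simp
  obtain \<kappa> p where kp: "endomorphism \<kappa>" "endomorphism p" "\<forall>v. u (\<kappa> v) = 0" "\<forall>v. p v \<in> ?W"
      "\<forall>w\<in>?W. p (\<kappa> w) = w" "\<forall>v\<in>span (B \<union> h ` B). p v = 0"
    by (rule kernel_copy_exists[OF inf u B fin])
  have pW: "p w = 0" if "w \<in> ?W" for w
    using kp(6) that span_mono[of B "B \<union> h ` B"] by blast
  have pg: "p (g w) = 0" for w
    using kp(6) g(3) span_mono[of "h ` B" "B \<union> h ` B"] by blast
  obtain q1 where q1: "endomorphism q1" "range q1 = ?W" "\<forall>w\<in>?W. q1 w = w"
    by (rule projection_exists[OF subspace_span])
  define \<phi> where "\<phi> = (\<lambda>w. g w + \<kappa> w)"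
  \<comment> \<open>The sum of the two coordinates on \<open>W \<oplus> \<phi> W\<close>: \<open>p\<close> gives the one along \<open>\<phi> W\<close>, and
    \<open>q1\<close> projects the rest \<open>v - \<phi> (p v)\<close> to \<open>W\<close>.\<close>
  define q where "q = (\<lambda>v. q1 v + p v - q1 (\<phi> (p v)))"
  have \<phi>: "endomorphism \<phi>"
    unfolding \<phi>_def by (rule endomorphism_plus[OF g(1) kp(1)])
  have q: "endomorphism q"
    unfolding q_def by (intro endomorphism_minus endomorphism_plus q1(1) kp(2)
      endomorphism_compose[OF q1(1) endomorphism_compose[OF \<phi> kp(2)]])
  have u\<phi>: "u (\<phi> w) = U w" if "w \<in> ?W" for w
    using that ug kp(3) by (simp add: \<phi>_def endomorphism_add[OF u])
  have qW: "q w = w" if "w \<in> ?W" for w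
    using that pW q1(3) by (simp add: q_def endomorphism_0[OF \<phi>] endomorphism_0[OF q1(1)])
  have q\<phi>: "q (\<phi> w) = w" if "w \<in> ?W" for w
  proof -
    have "p (\<phi> w) = w"
      using that kp(5) pg by (simp add: \<phi>_def endomorphism_add[OF kp(2)])
    then show ?thesis by (simp add: q_def)
  qed
  have q_in: "q v \<in> ?W" for v
    unfolding q_def using q1(2) kp(4) by (blast intro: span_add span_diff)
  define c where "c = (\<lambda>v. U (q v) - \<phi> (U (q v)))"
  have Uq: "endomorphism (\<lambda>v. U (q v))"
    by (rule endomorphism_compose[OF Ue q])
  have c: "endomorphism c"
    unfolding c_def by (rule endomorphism_minus[OF Uq endomorphism_compose[OF \<phi> Uq]])
  have "c (c v) = 0" for v
  proof -
    have "q (c v) = 0"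
      unfolding c_def using qW q\<phi> inW q_in by (simp add: endomorphism_diff[OF q])
    then show ?thesis
      by (simp add: c_def endomorphism_0[OF Ue] endomorphism_0[OF \<phi>])
  qed
  then have sq: "square_zero c"
    using c by (simp add: square_zero_def fun_eq_iff)
  define n where "n = (\<lambda>v. u v - c v)"
  have n: "endomorphism n"
    unfolding n_def by (rule endomorphism_minus[OF u c])
  have nW: "n w = L w + \<phi> (U w)" if "w \<in> ?W" for w
    using that eq qW by (simp add: n_def c_def)
  have n\<phi>: "n (\<phi> w) = \<phi> (U w)" if "w \<in> ?W" for w
    using that u\<phi> q\<phi> by (simp add: n_def c_def)
  obtain k where k: "\<forall>v\<in>?W. (L ^^ k) v = 0"
    using L by (auto simp: nilpotent_on_def)
  obtain m where m: "\<forall>v\<in>?W. (U ^^ m) v = 0"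
    using U by (auto simp: nilpotent_on_def)
  have pow\<phi>: "(n ^^ j) (\<phi> w) = \<phi> ((U ^^ j) w)" if "w \<in> ?W" for w j
    using n\<phi> nilpotent_on_funpow_in[OF U that] by (induction j) auto
  have zero\<phi>: "(n ^^ m) (\<phi> w) = 0" if "w \<in> ?W" for w
    using pow\<phi>[OF that] m that by (simp add: endomorphism_0[OF \<phi>])
  have powW: "\<exists>w'\<in>?W. (n ^^ j) w = (L ^^ j) w + \<phi> w'" if w: "w \<in> ?W" for w j
  proof (induction j)
    case 0
    show ?case
      by (rule bexI[of _ 0]) (simp_all add: endomorphism_0[OF \<phi>] span_zero)
  next
    case (Suc j)
    then obtain w' where w': "w' \<in> ?W" "(n ^^ j) w = (L ^^ j) w + \<phi> w'" by blast
    have Lj: "(L ^^ j) w \<in> ?W"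
      by (rule nilpotent_on_funpow_in[OF L w])
    show ?case
    proof (rule bexI[of _ "U ((L ^^ j) w) + U w'"])
      show "(n ^^ Suc j) w = (L ^^ Suc j) w + \<phi> (U ((L ^^ j) w) + U w')"
        using nW[OF Lj] n\<phi>[OF w'(1)] w'(2)
        by (simp add: endomorphism_add[OF n] endomorphism_add[OF \<phi>] add.assoc)
    qed (use inW Lj w' in \<open>simp add: span_add\<close>)
  qed
  have zeroW: "(n ^^ (m + k)) w = 0" if w: "w \<in> ?W" for w
  proof -
    obtain w' where w': "w' \<in> ?W" "(n ^^ k) w = (L ^^ k) w + \<phi> w'"
      using powW[OF w] by blast
    then show ?thesis
      using k w zero\<phi> by (simp add: funpow_add)
  qed
  have "(n ^^ Suc (m + k)) v = 0" for v
  proof -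
    have "n v = (u v - U (q v)) + \<phi> (U (q v))"
      by (simp add: n_def c_def)
    moreover have "u v - U (q v) \<in> ?W"
      using uW inW q_in by (simp add: span_diff)
    moreover have "(n ^^ (m + k)) (\<phi> (U (q v))) = 0"
      using funpow_zero_mono[OF n zero\<phi>] inW q_in by simp
    ultimately have "(n ^^ (m + k)) (n v) = 0"
      using zeroW endomorphism_add[OF endomorphism_funpow[OF n]] by simp
    then show ?thesis
      by (simp add: funpow_swap1)
  qed
  then have "\<forall>v. ((\<lambda>v. u v - c v) ^^ Suc (m + k)) v = 0"
    unfolding n_def by (rule allI)
  then show thesis
    by (rule that[OF sq])
qed

section \<open>The endomorphism \<open>u\<close> is scalar on its range\<close>

text \<open>On a basis \<open>b\<^sub>0, \<dots>, b\<^sub>r\<^sub>-\<^sub>1\<close> take \<open>M b\<^sub>k = k b\<^sub>k\<close>, and let \<open>T\<close> shift the basis cyclically. When the number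
  of basis vectors vanishes in the field, the eigenvalues of \<open>M\<close> increase by one all around the
  cycle, and so \<open>T\<close> conjugates \<open>1 + M\<close> to \<open>M\<close>.\<close>

lemma cyclic_shift_exists:
  assumes B: "finite B" "independent B" and r: "of_nat (card B) = (0::'a)"
  obtains M T T' where "endomorphism M" "endomorphism T" "endomorphism T'"
    "\<forall>w\<in>span B. M w \<in> span B" "\<forall>w\<in>span B. T w \<in> span B" "\<forall>w\<in>span B. T' w \<in> span B"
    "\<forall>w\<in>span B. T (T' w) = w" "\<forall>w\<in>span B. T' (T w) = w"
    "\<forall>w\<in>span B. T (w + M w) = M (T w)"
proof -
  let ?r = "card B"
  obtain e where e: "bij_betw e {0..<?r} B"
    using ex_bij_betw_nat_finite[OF B(1)] by blast
  define i where "i = inv_into {0..<?r} e"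
  have ei: "e (i b) = b" "i b < ?r" if "b \<in> B" for b
    using e that inv_into_into[of b e "{0..<?r}"]
    by (auto simp: i_def bij_betw_def f_inv_into_f)
  have ie: "i (e k) = k" "e k \<in> B" if "k < ?r" for k
    using e that by (auto simp: i_def bij_betw_def)
  define \<sigma> where "\<sigma> b = e (Suc (i b) mod ?r)" for b
  have \<sigma>B: "\<sigma> b \<in> B" and i\<sigma>: "i (\<sigma> b) = Suc (i b) mod ?r" if "b \<in> B" for b
    using ie[of "Suc (i b) mod ?r"] ei(2)[OF that] by (simp_all add: \<sigma>_def)
  have nat: "of_nat (i (\<sigma> b)) = (of_nat (i b) + 1 :: 'a)" if "b \<in> B" for b
  proof (cases "Suc (i b) = ?r")
    case True
    then have "of_nat (i (\<sigma> b)) = (of_nat ?r :: 'a)"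
      using i\<sigma>[OF that] r by simp
    also have "\<dots> = of_nat (i b) + 1"
      unfolding True[symmetric] by (simp add: add.commute)
    finally show ?thesis .
  next
    case False
    then have "i (\<sigma> b) = Suc (i b)"
      using i\<sigma>[OF that] ei(2)[OF that] by simp
    then show ?thesis
      by (simp add: add.commute)
  qed
  have "inj_on \<sigma> B"
  proof (rule inj_onI)
    fix b b' assume b: "b \<in> B" "b' \<in> B" "\<sigma> b = \<sigma> b'"
    then have "Suc (i b) mod ?r = Suc (i b') mod ?r"
      using i\<sigma> by metis
    then have "i b = i b'"
      using ei(2) b by (auto simp: mod_Suc split: if_splits)
    then show "b = b'"
      using ei(1) b by metis
  qed
  then have \<sigma>: "bij_betw \<sigma> B B"
    using \<sigma>B B(1) by (simp add: bij_betw_def endo_inj_surj image_subset_iff)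
  define \<tau> where "\<tau> = inv_into B \<sigma>"
  have \<tau>: "\<tau> b \<in> B" "\<sigma> (\<tau> b) = b" "\<tau> (\<sigma> b) = b" if "b \<in> B" for b
    using \<sigma> that inv_into_into[of b \<sigma> B] by (auto simp: \<tau>_def bij_betw_def f_inv_into_f)
  obtain M where M: "endomorphism M" "\<forall>b\<in>B. M b = of_nat (i b) *s b"
      "range M = span ((\<lambda>b. of_nat (i b) *s b) ` B)"
    by (rule endomorphism_extend[OF B(2)])
  obtain T where T: "endomorphism T" "\<forall>b\<in>B. T b = \<sigma> b" "range T = span (\<sigma> ` B)"
    by (rule endomorphism_extend[OF B(2)])
  obtain T' where T': "endomorphism T'" "\<forall>b\<in>B. T' b = \<tau> b" "range T' = span (\<tau> ` B)"
    by (rule endomorphism_extend[OF B(2)])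
  show thesis
  proof (rule that[OF M(1) T(1) T'(1)])
    show "\<forall>w\<in>span B. M w \<in> span B"
      using endomorphism_span_into[OF M(1) subspace_span, of B B] M(2)
      by (simp add: span_base span_scale)
    show "\<forall>w\<in>span B. T w \<in> span B"
      using endomorphism_span_into[OF T(1) subspace_span, of B B] T(2) \<sigma>B
      by (simp add: span_base)
    show "\<forall>w\<in>span B. T' w \<in> span B"
      using endomorphism_span_into[OF T'(1) subspace_span, of B B] T'(2) \<tau>
      by (simp add: span_base)
    show "\<forall>w\<in>span B. T (T' w) = w"
      using endomorphism_eq_on_span[OF endomorphism_compose[OF T(1) T'(1)] endomorphism_ident, of B]
        T(2) T'(2) \<tau> by simp
    show "\<forall>w\<in>span B. T' (T w) = w"
      using endomorphism_eq_on_span[OF endomorphism_compose[OF T'(1) T(1)] endomorphism_ident, of B]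
        T(2) T'(2) \<tau> \<sigma>B by simp
    have "T (b + M b) = M (T b)" if "b \<in> B" for b
      using that T(2) M(2) \<sigma>B nat
      by (simp add: endomorphism_add[OF T(1)] endomorphism_scale[OF T(1)] scale_left_distrib)
    then show "\<forall>w\<in>span B. T (w + M w) = M (T w)"
      using endomorphism_eq_on_span[OF
          endomorphism_compose[OF T(1) endomorphism_plus[OF endomorphism_ident M(1)]]
          endomorphism_compose[OF M(1) T(1)], of B] by simp
  qed
qed

text \<open>Let \<open>q = u / \<mu>\<close>, a projection onto the range \<open>W\<close>, and let \<open>\<kappa> W\<close> be a copy of \<open>W\<close> in the
  kernel. The embeddings \<open>f\<close> and \<open>g\<close> give new coordinates \<open>\<alpha>, \<beta>\<close> on \<open>W \<oplus> \<kappa> W\<close> in which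
  \<open>q\<close> has the block rows \<open>(1 + M, -(1 + M) M)\<close> and \<open>(1, -M)\<close>. An endomorphism with zero
  diagonal blocks is the sum of two square-zero ones, namely its two off-diagonal blocks. So
  it is enough to find a square-zero \<open>c\<close> with diagonal blocks \<open>\<mu> (1 + M)\<close> and \<open>-\<mu> M\<close>. As
  \<open>T (1 + M) = M T\<close>, such a \<open>c\<close> is \<open>\<mu> (f + g T) (1 + M) (\<alpha> - T' \<beta>)\<close>: its square vanishes because
  \<open>\<alpha> - T' \<beta>\<close> kills the image of \<open>f + g T\<close>.\<close>
lemma scalar_on_range_sum_of_three_square_zero:
  assumes inf: "\<And>S. finite S \<Longrightarrow> span S \<noteq> UNIV"
    and u: "endomorphism u" and B: "finite B" "independent B" "range u = span B"
    and r: "of_nat (card B) = (0::'a)"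
    and \<mu>: "\<mu> \<noteq> 0" "\<forall>w\<in>span B. u w = \<mu> *s w"
  obtains a b c where "square_zero a" "square_zero b" "square_zero c" "\<forall>v. u v = a v + b v + c v"
proof -
  let ?W = "span B"
  obtain M T T' where MT: "endomorphism M" "endomorphism T" "endomorphism T'"
    "\<forall>w\<in>?W. M w \<in> ?W" "\<forall>w\<in>?W. T w \<in> ?W" "\<forall>w\<in>?W. T' w \<in> ?W"
    "\<forall>w\<in>?W. T (T' w) = w" "\<forall>w\<in>?W. T' (T w) = w" "\<forall>w\<in>?W. T (w + M w) = M (T w)"
    by (rule cyclic_shift_exists[OF B(1,2) r])
  obtain \<kappa> p where kp: "endomorphism \<kappa>" "endomorphism p" "\<forall>v. u (\<kappa> v) = 0" "\<forall>v. p v \<in> ?W"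
      "\<forall>w\<in>?W. p (\<kappa> w) = w" "\<forall>v\<in>?W. p v = 0"
    by (rule kernel_copy_exists[OF inf u B B(1)])
  define q where "q = (\<lambda>v. inverse \<mu> *s u v)"
  have q: "endomorphism q"
    unfolding q_def by (rule endomorphism_smult[OF u])
  have qW: "q w = w" if "w \<in> ?W" for w
    using that \<mu> by (simp add: q_def)
  have qk: "q (\<kappa> w) = 0" for w
    using kp(3) by (simp add: q_def)
  have uq: "u v = \<mu> *s q v" for v
    using \<mu>(1) by (simp add: q_def)
  have q_in: "q v \<in> ?W" for v
    using B(3) by (auto simp: q_def intro: span_scale)
  define f where "f = (\<lambda>w. w - \<kappa> w)"
  define g where "g = (\<lambda>w. \<kappa> w + \<kappa> (M w) - M w)"
  define \<alpha> where "\<alpha> = (\<lambda>v. q v + M (q v) + M (p v))"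
  define \<beta> where "\<beta> = (\<lambda>v. q v + p v)"
  have f: "endomorphism f"
    unfolding f_def by (intro endomorphism_minus endomorphism_ident kp(1))
  have g: "endomorphism g"
    unfolding g_def by (intro endomorphism_minus endomorphism_plus kp(1) MT(1)
      endomorphism_compose[OF kp(1) MT(1)])
  have \<alpha>: "endomorphism \<alpha>"
    unfolding \<alpha>_def by (intro endomorphism_plus q endomorphism_compose[OF MT(1) q]
      endomorphism_compose[OF MT(1) kp(2)])
  have \<beta>: "endomorphism \<beta>"
    unfolding \<beta>_def by (intro endomorphism_plus q kp(2))
  have in_W: "\<alpha> v \<in> ?W" "\<beta> v \<in> ?W" for v
    unfolding \<alpha>_def \<beta>_def using q_in kp(4) MT(4) by (simp_all add: span_add)
  note adds = endomorphism_add[OF q] endomorphism_diff[OF q] endomorphism_0[OF q]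
    endomorphism_add[OF kp(2)] endomorphism_diff[OF kp(2)] endomorphism_0[OF kp(2)]
    endomorphism_add[OF MT(1)] endomorphism_diff[OF MT(1)] endomorphism_neg[OF MT(1)]
    endomorphism_0[OF MT(1)]
  have fg: "\<alpha> (f w) = w" "\<beta> (f w) = 0" "\<alpha> (g w) = 0" "\<beta> (g w) = w" if w: "w \<in> ?W" for w
  proof -
    have Mw: "M w \<in> ?W" using MT(4) w by blast
    show "\<alpha> (f w) = w" "\<beta> (f w) = 0" "\<alpha> (g w) = 0" "\<beta> (g w) = w"
      using w Mw kp(5,6) by (simp_all add: \<alpha>_def \<beta>_def f_def g_def adds qW qk)
  qed
  have shift: "T w + T (M w) = M (T w)" if "w \<in> ?W" for w
    using MT(9) that endomorphism_add[OF MT(2)] by simp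
  define P where "P = (\<lambda>w. w + M w)"
  have P: "endomorphism P"
    unfolding P_def by (intro endomorphism_plus endomorphism_ident MT(1))
  have PW: "P w \<in> ?W" if "w \<in> ?W" for w
    using that MT(4) by (simp add: P_def span_add)
  have TW: "T w \<in> ?W" "T' w \<in> ?W" "M w \<in> ?W" if "w \<in> ?W" for w
    using that MT(4-6) by auto
  define a where "a = (\<lambda>v. \<mu> *s g (\<alpha> v - T (P (\<alpha> v))))"
  define b where "b = (\<lambda>v. \<mu> *s f (P (T' (\<beta> v) - M (\<beta> v))))"
  define c where "c = (\<lambda>v. \<mu> *s (f (P (\<alpha> v - T' (\<beta> v))) + g (T (P (\<alpha> v - T' (\<beta> v))))))"
  have T'\<beta>: "endomorphism (\<lambda>v. T' (\<beta> v))"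
    by (rule endomorphism_compose[OF MT(3) \<beta>])
  have y: "endomorphism (\<lambda>v. P (\<alpha> v - T' (\<beta> v)))"
    by (rule endomorphism_compose[OF P endomorphism_minus[OF \<alpha> T'\<beta>]])
  have ea: "endomorphism a"
    unfolding a_def
    by (intro endomorphism_smult endomorphism_compose[OF g] endomorphism_minus \<alpha>
      endomorphism_compose[OF MT(2) endomorphism_compose[OF P \<alpha>]])
  have eb: "endomorphism b"
    unfolding b_def
    by (intro endomorphism_smult endomorphism_compose[OF f] endomorphism_compose[OF P]
      endomorphism_minus T'\<beta> endomorphism_compose[OF MT(1) \<beta>])
  have ec: "endomorphism c"
    unfolding c_def
    by (intro endomorphism_smult endomorphism_plus endomorphism_compose[OF f y]
      endomorphism_compose[OF g endomorphism_compose[OF MT(2) y]])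
  have y_in: "P (\<alpha> v - T' (\<beta> v)) \<in> ?W" for v
    by (intro PW span_diff in_W TW)
  have "\<alpha> (a v) = 0" for v
    unfolding a_def using in_W TW PW fg(3) by (simp add: endomorphism_scale[OF \<alpha>] span_diff)
  then have sa: "square_zero a"
    using ea by (simp add: square_zero_def fun_eq_iff) (simp add: a_def endomorphism_0[OF g]
      endomorphism_0[OF P] endomorphism_0[OF MT(2)])
  have "\<beta> (b v) = 0" for v
    unfolding b_def using in_W TW PW fg(2) by (simp add: endomorphism_scale[OF \<beta>] span_diff)
  then have sb: "square_zero b"
    using eb by (simp add: square_zero_def fun_eq_iff) (simp add: b_def endomorphism_0[OF f]
      endomorphism_0[OF P] endomorphism_0[OF MT(3)] endomorphism_0[OF MT(1)])
  have "\<alpha> (c v) = T' (\<beta> (c v))" for v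
    unfolding c_def using y_in[of v] TW fg MT(8)
    by (simp add: endomorphism_scale[OF \<alpha>] endomorphism_scale[OF \<beta>] endomorphism_scale[OF MT(3)]
      endomorphism_add[OF \<alpha>] endomorphism_add[OF \<beta>])
  then have sc: "square_zero c"
    using ec by (simp add: square_zero_def fun_eq_iff) (simp add: c_def endomorphism_0[OF f]
      endomorphism_0[OF g] endomorphism_0[OF P] endomorphism_0[OF MT(2)])
  have "u v = a v + b v + c v" for v
  proof -
    have "T (P (T' (\<beta> v))) = M (\<beta> v)"
      using MT(7,9) in_W TW by (simp add: P_def)
    then have "a v + b v + c v = \<mu> *s (g (\<alpha> v - M (\<beta> v)) + f (P (\<alpha> v - M (\<beta> v))))"
      unfolding a_def b_def c_def
      by (simp add: endomorphism_add[OF f] endomorphism_diff[OF f] endomorphism_add[OF g]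
        endomorphism_diff[OF g] endomorphism_diff[OF P] endomorphism_diff[OF MT(2)]
        scale_right_distrib[symmetric] del: scale_right_distrib)
    also have "\<alpha> v - M (\<beta> v) = q v"
      by (simp add: \<alpha>_def \<beta>_def adds)
    also have "g (q v) + f (P (q v)) = q v"
      by (simp add: g_def f_def P_def endomorphism_add[OF kp(1)])
    finally show ?thesis
      by (simp add: uq)
  qed
  then have "\<forall>v. u v = a v + b v + c v" ..
  then show thesis
    by (rule that[OF sa sb sc])
qed

section \<open>Finite-rank endomorphisms of trace zero\<close>

lemma trace_zero_sum_of_three_square_zero:
  assumes inf: "\<And>S. finite S \<Longrightarrow> span S \<noteq> UNIV"
    and u: "endomorphism u" and fr: "finite_rank u" and tr: "finite_rank_trace u = 0"
  shows "\<exists>a b c. square_zero a \<and> square_zero b \<and> square_zero c \<and> u = (\<lambda>x. a x + b x + c x)"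
proof -
  obtain B where B: "{} \<subseteq> B" "finite B" "independent B" "span B = range u"
    by (rule finite_dim_subspace_basis[OF fr[unfolded finite_rank_def] independent_empty empty_subsetI])
  note B = B(2-4)
  have inv: "u ` span B \<subseteq> span B"
    using B(3) by blast
  have "trace_on (range u) u = 0"
    using finite_rank_trace_eq[OF u _ order_refl] fr tr by (simp add: finite_rank_def)
  then have t: "(\<Sum>b\<in>B. representation B (u b) b) = 0"
    using trace_on_eq[OF u B] inv B(3) by simp
  show ?thesis
  proof (cases "\<exists>\<mu>. \<mu> \<noteq> 0 \<and> (\<forall>v\<in>span B. u v = \<mu> *s v)")
    case True
    then obtain \<mu> where \<mu>: "\<mu> \<noteq> 0" "\<forall>v\<in>span B. u v = \<mu> *s v" by blast
    \<comment> \<open>The trace is \<open>\<mu>\<close> times the rank, so the rank vanishes in the field.\<close>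
    have "representation B (u b) b = \<mu>" if "b \<in> B" for b
      using that \<mu>(2) B(2) by (simp add: span_base representation_scale representation_basis)
    then have "of_nat (card B) * \<mu> = 0"
      using t by simp
    then have r: "of_nat (card B) = (0::'a)"
      using \<mu>(1) by simp
    obtain a b c where abc: "square_zero a" "square_zero b" "square_zero c"
        "\<forall>v. u v = a v + b v + c v"
      by (rule scalar_on_range_sum_of_three_square_zero[OF inf u B(1,2) B(3)[symmetric] r \<mu>])
    show ?thesis
      by (intro exI[of _ a] exI[of _ b] exI[of _ c] conjI abc(1-3) ext) (use abc(4) in blast)
  next
    case False
    then have ns: "\<forall>\<mu>. (\<forall>v\<in>span B. u v = \<mu> *s v) \<longrightarrow> (\<forall>v\<in>span B. u v = 0)"
      by (metis scale_zero_left)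
    obtain L U where LU: "nilpotent_on (span B) L" "nilpotent_on (span B) U"
        "\<forall>v\<in>span B. u v = L v + U v"
      using trace_zero_sum_of_two_nilpotents[OF u B(1,2) inv t ns] by blast
    obtain c k where c: "square_zero c" "\<forall>v. ((\<lambda>v. u v - c v) ^^ k) v = 0"
      by (rule square_zero_plus_nilpotent[OF inf u B(1,2) B(3)[symmetric] LU])
    have n: "endomorphism (\<lambda>v. u v - c v)"
      using endomorphism_minus[OF u] c(1) by (simp add: square_zero_def)
    obtain a b where ab: "square_zero a" "square_zero b" "\<forall>x. u x - c x = a x + b x"
      by (rule nilpotent_sum_of_two_square_zero[OF n]) (use c(2) in auto)
    have "u x = a x + b x + c x" for x
      using ab(3)[rule_format, of x] by (metis diff_add_cancel)
    then show ?thesis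
      using ab(1,2) c(1) by (intro exI[of _ a] exI[of _ b] exI[of _ c]) (simp add: fun_eq_iff)
  qed
qed

end

theorem corollary1p5:
  fixes smult :: "'a::field \<Rightarrow> 'b::ab_group_add \<Rightarrow> 'b"
    and u :: "'b \<Rightarrow> 'b"
  assumes "vector_space smult"
    and "\<nexists>B. finite_dimensional_vector_space smult B"
    and "vector_space.endomorphism smult u"
    and "vector_space.finite_rank smult u"
    and "vector_space.finite_rank_trace smult u = 0"
  shows "\<exists>a b c. vector_space.square_zero smult a
    \<and> vector_space.square_zero smult b
    \<and> vector_space.square_zero smult c
    \<and> u = (\<lambda>x. a x + b x + c x)"
proof -
  interpret vector_space smult by (rule assms(1))
  have inf: "span S \<noteq> UNIV" if S: "finite S" for S
  proof
    assume UNIV: "span S = UNIV"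
    obtain B where B: "B \<subseteq> S" "independent B" "S \<subseteq> span B"
      using maximal_independent_subset by blast
    have "span B = UNIV"
      using UNIV span_minimal[OF B(3) subspace_span] by auto
    then have "finite_dimensional_vector_space smult B"
      using B S finite_subset by unfold_locales auto
    then show False
      using assms(2) by blast
  qed
  show ?thesis
    by (rule trace_zero_sum_of_three_square_zero[OF inf assms(3-5)])
qed

end
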